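(* Let $m\in\mathbb Z\setminus\{0\}$ and $\xi\in\mathbb Z_m$. Define elements of the free group $\mathbb F(a,b)$ by $b_1=ab^ma^{-1}$ and $b_i=ab_{i-1}b^{-r_{i-1}(\xi)}a^{-1}$ for $i\ge2$. Then the marked group $\overline{BS}(m,\xi)$ admits the presentation $$\overline{BS}(m,\xi)=\langle a,b\mid [b,b_i]=1,\ i\ge1\rangle.$$ In particular $\overline{BS}(m,0)=\langle a,b\mid [b,a^ib^ma^{-i}]=1,\ i\ge1\rangle$, and this latter presentation is minimal: for every $k\ge1$, the relation $[b,a^kb^ma^{-k}]=1$ does not hold in the group $\langle a,b\mid [b,a^ib^ma^{-i}]=1,\ i\ge1,\ i\ne k\rangle$.
   Context: For $p,q\in\mathbb Z\setminus\{0\}$, $BS(p,q)=\langle a,b\mid ab^pa^{-1}=b^q\rangle$, marked by $(a,b)$. The space of marked groups on two generators $\mathcal G_2$ is the set of normal subgroups of the free group $\mathbb F(a,b)$, with the ultrametric $d(N_1,N_2)=e^{-\lambda}$ ($N_1\ne N_2$), $\lambda$ the minimal word length of an element of $N_1\triangle N_2$. $\mathbb Z_m=\varprojlim\mathbb Z/m^h\mathbb Z$ is the ring of $m$-adic integers. For $\xi\in\mathbb Z_m$, $\overline{BS}(m,\xi)$ denotes the limit in $\mathcal G_2$ of $BS(m,\xi_n)$ for any sequence of integers $(\xi_n)$ with $|\xi_n|\to\infty$ and $\xi_n\to\xi$ in $\mathbb Z_m$ (this limit exists and is independent of the sequence), marked by the images of $a,b$. The functions $r_i$: $r_0(\xi)=0$,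 $s_0(\xi)=1$, and for $i\ge1$, $r_i(\xi)\in\{0,\dots,|m|-1\}$, $s_i(\xi)\in\mathbb Z_m$ are the unique elements with $\xi s_{i-1}(\xi)=m s_i(\xi)+r_i(\xi)$. Note $r_i(0)=0$ for all $i$. *)

theory Defs
  imports Main
begin

datatype gen = GA | GB

text \<open>A letter is a generator together with an exponent flag (True = inverse).\<close>
type_synonym letter = "gen \<times> bool"
type_synonym word = "letter list"

definition linv :: "letter \<Rightarrow> letter" where
  "linv x = (fst x, \<not> snd x)"

definition winv :: "word \<Rightarrow> word" where
  "winv w = rev (map linv w)"

definition wa :: word where "wa = [(GA, False)]"
definition wb :: word where "wb = [(GB, False)]"

fun wpow_nat :: "word \<Rightarrow> nat \<Rightarrow> word" where
  "wpow_nat w 0 = []"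
| "wpow_nat w (Suc n) = w @ wpow_nat w n"

definition wpow :: "word \<Rightarrow> int \<Rightarrow> word" where
  "wpow w k = (if 0 \<le> k then wpow_nat w (nat k) else wpow_nat (winv w) (nat (- k)))"

definition comm :: "word \<Rightarrow> word \<Rightarrow> word" where
  "comm u v = u @ v @ winv u @ winv v"

inductive wequiv :: "word set \<Rightarrow> word \<Rightarrow> word \<Rightarrow> bool" for R where
  refl: "wequiv R w w"
| sym: "wequiv R u v \<Longrightarrow> wequiv R v u"
| trans: "wequiv R u v \<Longrightarrow> wequiv R v w \<Longrightarrow> wequiv R u w"
| cancel: "wequiv R (u @ [x, linv x] @ v) (u @ v)"
| rel: "r \<in> R \<Longrightarrow> wequiv R (u @ r @ v) (u @ v)"

text \<open>The marked group <a,b | R>, represented by its kernel: the normal closure of R in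
  F(a,b), given as the set of all words representing elements of it.\<close>
definition presented :: "word set \<Rightarrow> word set" where
  "presented R = {w. wequiv R w []}"

text \<open>Convergence in the space of marked groups: for every length bound l, eventually
  the kernels agree on all elements of word length at most l.\<close>
definition mconv :: "(nat \<Rightarrow> word set) \<Rightarrow> word set \<Rightarrow> bool" where
  "mconv N L \<longleftrightarrow>
     (\<forall>l::nat. eventually (\<lambda>n. \<forall>w. length w \<le> l \<longrightarrow> (w \<in> N n \<longleftrightarrow> w \<in> L)) sequentially)"

definition BS :: "int \<Rightarrow> int \<Rightarrow> word set" where
  "BS p q = presented {wa @ wpow wb p @ winv wa @ wpow wb (- q)}"

definition Zm :: "int \<Rightarrow> (nat \<Rightarrow> int) set" where
  "Zm m = {x. \<forall>h. 0 \<le> x h \<and> x h < \<bar>m\<bar> ^ h \<and> x (Suc h) mod \<bar>m\<bar> ^ h = x h}"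

definition zm_of_int :: "int \<Rightarrow> int \<Rightarrow> (nat \<Rightarrow> int)" where
  "zm_of_int m n = (\<lambda>h. n mod \<bar>m\<bar> ^ h)"

definition zm_add :: "int \<Rightarrow> (nat \<Rightarrow> int) \<Rightarrow> (nat \<Rightarrow> int) \<Rightarrow> (nat \<Rightarrow> int)" where
  "zm_add m x y = (\<lambda>h. (x h + y h) mod \<bar>m\<bar> ^ h)"

definition zm_mult :: "int \<Rightarrow> (nat \<Rightarrow> int) \<Rightarrow> (nat \<Rightarrow> int) \<Rightarrow> (nat \<Rightarrow> int)" where
  "zm_mult m x y = (\<lambda>h. (x h * y h) mod \<bar>m\<bar> ^ h)"

fun r_s :: "int \<Rightarrow> (nat \<Rightarrow> int) \<Rightarrow> nat \<Rightarrow> int \<times> (nat \<Rightarrow> int)" where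
  "r_s m \<xi> 0 = (0, zm_of_int m 1)"
| "r_s m \<xi> (Suc i) = (THE p. case p of (r, s) \<Rightarrow>
      0 \<le> r \<and> r < \<bar>m\<bar> \<and> s \<in> Zm m \<and>
      zm_mult m \<xi> (snd (r_s m \<xi> i)) = zm_add m (zm_mult m (zm_of_int m m) s) (zm_of_int m r))"

definition r_fun :: "int \<Rightarrow> (nat \<Rightarrow> int) \<Rightarrow> nat \<Rightarrow> int" where
  "r_fun m \<xi> i = fst (r_s m \<xi> i)"

fun bword :: "int \<Rightarrow> (nat \<Rightarrow> int) \<Rightarrow> nat \<Rightarrow> word" where
  "bword m \<xi> 0 = []"
| "bword m \<xi> (Suc 0) = wa @ wpow wb m @ winv wa"
| "bword m \<xi> (Suc (Suc i)) =
     wa @ bword m \<xi> (Suc i) @ wpow wb (- r_fun m \<xi> (Suc i)) @ winv wa"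

definition barBS :: "int \<Rightarrow> (nat \<Rightarrow> int) \<Rightarrow> word set" where
  "barBS m \<xi> = (THE L. \<forall>seq :: nat \<Rightarrow> int.
      (filterlim (\<lambda>n. \<bar>seq n\<bar>) at_top sequentially \<and>
       (\<forall>h. eventually (\<lambda>n. zm_of_int m (seq n) h = \<xi> h) sequentially))
      \<longrightarrow> mconv (\<lambda>n. BS m (seq n)) L)"

end

theory Submission
  imports Defs
begin

text \<open>
  The group \<open>\<langle>a, b | [b, b\<^sub>i] = 1\<rangle>\<close> is an HNN extension of a free abelian group on
  \<open>b, b\<^sub>1, b\<^sub>2, \<dots>\<close>, and \<open>BS m q\<close> is an HNN extension of the infinite cyclic group on b. Reading a
  word from the right and keeping an HNN normal form gives a deterministic machine for each of them.
  When q is large and m-adically close to \<open>\<xi>\<close>, the generator \<open>b\<^sub>i\<close> is a power of b in \<open>BS m q\<close>, and this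
  evaluation of the base group carries the normal form in the limit group to the one in \<open>BS m q\<close>.
  Hence a word is trivial in the limit group if and only if it is trivial in \<open>BS m q\<close> for all q
  sufficiently close to the limit. The triviality test in \<open>BS m q\<close> is van der Waerden's argument: the
  machine is an action of \<open>BS m q\<close> on normal forms. In the limit group it suffices that the machine
  rewrites words using the given relators.
\<close>

subsection \<open>Words modulo relators\<close>

lemmas wequiv_trans [trans] = wequiv.trans

lemma linv_linv [simp]: "linv (linv x) = x"
  by (simp add: linv_def)

lemma winv_append [simp]: "winv (u @ v) = winv v @ winv u"
  by (simp add: winv_def)

lemma winv_winv [simp]: "winv (winv u) = u"
  by (simp add: winv_def rev_map comp_def)

lemma wequiv_append_left: "wequiv R u v \<Longrightarrow> wequiv R (x @ u) (x @ v)"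
proof (induction rule: wequiv.induct)
  case (cancel u y v)
  show ?case using wequiv.cancel[of R "x @ u" y v] by simp
next
  case (rel r u v)
  show ?case using wequiv.rel[OF rel, of "x @ u" v] by simp
qed (blast intro: wequiv.intros)+

lemma wequiv_append_right: "wequiv R u v \<Longrightarrow> wequiv R (u @ y) (v @ y)"
proof (induction rule: wequiv.induct)
  case (cancel u x v)
  show ?case using wequiv.cancel[of R u x "v @ y"] by simp
next
  case (rel r u v)
  show ?case using wequiv.rel[OF rel, of u "v @ y"] by simp
qed (blast intro: wequiv.intros)+

lemma wequiv_append: "wequiv R u u' \<Longrightarrow> wequiv R v v' \<Longrightarrow> wequiv R (u @ v) (u' @ v')"
  by (blast intro: wequiv.trans wequiv_append_left wequiv_append_right)

lemma wequiv_ctx: "wequiv R u v \<Longrightarrow> wequiv R (x @ u @ y) (x @ v @ y)"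
  by (intro wequiv_append wequiv.refl)

lemma wequiv_winv_right: "wequiv R (u @ winv u) []"
proof (induction u)
  case Nil
  show ?case by (simp add: winv_def wequiv.refl)
next
  case (Cons x u)
  have "wequiv R ([x] @ (u @ winv u) @ [linv x]) ([x] @ [] @ [linv x])"
    by (rule wequiv_ctx[OF Cons])
  also have "wequiv R ([x] @ [] @ [linv x]) []"
    using wequiv.cancel[of R "[]" x "[]"] by simp
  finally show ?case by (simp add: winv_def)
qed

lemma wequiv_winv_left: "wequiv R (winv u @ u) []"
  using wequiv_winv_right[of R "winv u"] by simp

lemma wequiv_winv_right_ctx: "wequiv R (x @ u @ winv u @ y) (x @ y)"
  using wequiv_ctx[OF wequiv_winv_right[of R u], of x y] by simp

lemma wequiv_winv_left_ctx: "wequiv R (x @ winv u @ u @ y) (x @ y)"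
  using wequiv_ctx[OF wequiv_winv_left[of R u], of x y] by simp

lemma wequiv_winv_move:
  assumes "wequiv R v (u @ w)"
  shows "wequiv R w (winv u @ v)"
proof -
  have "wequiv R (winv u @ v) (winv u @ u @ w)"
    using wequiv_append_left[OF assms] by simp
  also have "wequiv R (winv u @ u @ w) w"
    using wequiv_winv_left_ctx[of R "[]" u w] by simp
  finally show ?thesis by (rule wequiv.sym)
qed

lemma wequiv_comm_iff: "wequiv R (comm u v) [] \<longleftrightarrow> wequiv R (u @ v) (v @ u)"
proof
  assume "wequiv R (comm u v) []"
  then have "wequiv R (comm u v @ (v @ u)) (v @ u)"
    using wequiv_append_right by fastforce
  moreover have "wequiv R (comm u v @ (v @ u)) (u @ v)"
    using wequiv_winv_left_ctx[of R "u @ v" "v @ u" "[]"] by (simp add: comm_def)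
  ultimately show "wequiv R (u @ v) (v @ u)"
    by (blast intro: wequiv.intros)
next
  assume "wequiv R (u @ v) (v @ u)"
  then have "wequiv R ((u @ v) @ winv (v @ u)) ((v @ u) @ winv (v @ u))"
    by (rule wequiv_append_right)
  also have "wequiv R ((v @ u) @ winv (v @ u)) []"
    by (rule wequiv_winv_right)
  finally show "wequiv R (comm u v) []"
    by (simp add: comm_def)
qed

subsection \<open>Integer powers\<close>

lemma wpow_0 [simp]: "wpow u 0 = []"
  by (simp add: wpow_def)

lemma wpow_1 [simp]: "wpow u 1 = u"
  by (simp add: wpow_def)

lemma wpow_neg1 [simp]: "wpow u (- 1) = winv u"
  by (simp add: wpow_def)

lemma wpow_add1: "wequiv R (wpow u (k + 1)) (u @ wpow u k)"
proof (cases "k \<ge> 0")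
  case True
  then have "nat (k + 1) = Suc (nat k)" by simp
  then show ?thesis using True by (simp add: wpow_def wequiv.refl)
next
  case False
  then have "nat (- k) = Suc (nat (- (k + 1)))" by simp
  then have "wpow u k = winv u @ wpow_nat (winv u) (nat (- (k + 1)))"
    using False by (simp add: wpow_def)
  moreover have "wpow u (k + 1) = wpow_nat (winv u) (nat (- (k + 1)))"
    using False by (cases "k = -1") (simp_all add: wpow_def)
  ultimately show ?thesis
    using wequiv_winv_right_ctx[of R "[]" u] by (simp add: wequiv.sym)
qed

lemma wpow_sub1: "wequiv R (wpow u (k - 1)) (winv u @ wpow u k)"
  using wequiv_winv_move[OF wpow_add1[of R u "k - 1"]] by simp

text \<open>\<open>wpow\<close> is defined by cases on the sign of the exponent. The one-step
  recursion determines a function in both directions, so the power laws below reduce to checking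
  that recursion.\<close>

lemma wpow_unique:
  assumes zero: "wequiv R (f 0) []" and step: "\<And>k::int. wequiv R (f (k + 1)) (u @ f k)"
  shows "wequiv R (f k) (wpow u k)"
proof (induction k rule: int_induct[where k = 0])
  case base
  show ?case using zero by simp
next
  case (step1 i)
  have "wequiv R (f (i + 1)) (u @ f i)" by (rule step)
  also have "wequiv R (u @ f i) (u @ wpow u i)"
    by (rule wequiv_append_left[OF step1(2)])
  also have "wequiv R (u @ wpow u i) (wpow u (i + 1))"
    by (rule wequiv.sym[OF wpow_add1])
  finally show ?case .
next
  case (step2 i)
  have "wequiv R (f (i - 1)) (winv u @ f i)"
    using wequiv_winv_move[OF step[of "i - 1"]] by simp
  also have "wequiv R (winv u @ f i) (winv u @ wpow u i)"
    by (rule wequiv_append_left[OF step2(2)])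
  also have "wequiv R (winv u @ wpow u i) (wpow u (i - 1))"
    by (rule wequiv.sym[OF wpow_sub1])
  finally show ?case .
qed

lemma wpow_add: "wequiv R (wpow u (i + j)) (wpow u i @ wpow u j)"
proof -
  \<comment> \<open>Moving \<open>wpow u j\<close> to the left-hand side makes the value at exponent
    0 trivial, as \<open>wpow_unique\<close> requires.\<close>
  have "wequiv R (wpow u (i + j) @ winv (wpow u j)) (wpow u i)"
  proof (rule wpow_unique)
    show "wequiv R (wpow u (0 + j) @ winv (wpow u j)) []"
      by (simp add: wequiv_winv_right)
    show "wequiv R (wpow u (k + 1 + j) @ winv (wpow u j)) (u @ wpow u (k + j) @ winv (wpow u j))" for k
      using wequiv_append_right[OF wpow_add1[of R u "k + j"]] by (simp add: algebra_simps)
  qed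
  then have "wequiv R (wpow u (i + j) @ winv (wpow u j) @ wpow u j) (wpow u i @ wpow u j)"
    using wequiv_append_right by fastforce
  moreover have "wequiv R (wpow u (i + j)) (wpow u (i + j) @ winv (wpow u j) @ wpow u j)"
    using wequiv_winv_left_ctx[of R "wpow u (i + j)" "wpow u j" "[]"] by (simp add: wequiv.sym)
  ultimately show ?thesis by (blast intro: wequiv.trans)
qed

lemma wpow_cong:
  assumes "wequiv R u v"
  shows "wequiv R (wpow u k) (wpow v k)"
proof (rule wpow_unique)
  show "wequiv R (wpow u (i + 1)) (v @ wpow u i)" for i
    using wpow_add1 wequiv_append_right[OF assms] by (rule wequiv.trans)
qed (simp add: wequiv.refl)

lemma wpow_mult: "wequiv R (wpow u (i * k)) (wpow (wpow u i) k)"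
proof (rule wpow_unique)
  show "wequiv R (wpow u (i * (j + 1))) (wpow u i @ wpow u (i * j))" for j
    using wpow_add[of R u i "i * j"] by (simp add: algebra_simps)
qed (simp add: wequiv.refl)

lemma wpow_conj: "wequiv R (g @ wpow u k @ winv g) (wpow (g @ u @ winv g) k)"
proof (rule wpow_unique)
  show "wequiv R (g @ wpow u 0 @ winv g) []"
    by (simp add: wequiv_winv_right)
  fix j
  have "wequiv R (g @ wpow u (j + 1) @ winv g) (g @ (u @ wpow u j) @ winv g)"
    by (rule wequiv_ctx[OF wpow_add1])
  also have "wequiv R \<dots> ((g @ u) @ winv g @ g @ (wpow u j @ winv g))"
    using wequiv_winv_left_ctx[of R "g @ u" g "wpow u j @ winv g"]
    by (simp add: wequiv.sym)
  finally show "wequiv R (g @ wpow u (j + 1) @ winv g) ((g @ u @ winv g) @ g @ wpow u j @ winv g)"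
    by simp
qed

text \<open>Conjugation by u fixes v, hence fixes every power of v.\<close>

lemma wequiv_commute_wpow:
  assumes "wequiv R (u @ v) (v @ u)"
  shows "wequiv R (u @ wpow v k) (wpow v k @ u)"
proof -
  have conj: "wequiv R (u @ v @ winv u) v"
  proof -
    have "wequiv R ((u @ v) @ winv u) ((v @ u) @ winv u)"
      by (rule wequiv_append_right[OF assms])
    also have "wequiv R ((v @ u) @ winv u) v"
      using wequiv_winv_right_ctx[of R v u "[]"] by simp
    finally show ?thesis by simp
  qed
  have "wequiv R (u @ wpow v k @ winv u) (wpow v k)"
    using wpow_conj wpow_cong[OF conj] by (rule wequiv.trans)
  then have "wequiv R ((u @ wpow v k @ winv u) @ u) (wpow v k @ u)"
    by (rule wequiv_append_right)
  moreover have "wequiv R ((u @ wpow v k @ winv u) @ u) (u @ wpow v k)"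
    using wequiv_winv_left_ctx[of R "u @ wpow v k" u "[]"] by simp
  ultimately show ?thesis by (blast intro: wequiv.intros)
qed

lemma wequiv_commute_wpow_wpow:
  assumes "wequiv R (u @ v) (v @ u)"
  shows "wequiv R (wpow u j @ wpow v k) (wpow v k @ wpow u j)"
  using wequiv_commute_wpow[OF wequiv.sym[OF wequiv_commute_wpow[OF assms]]]
  by (rule wequiv.sym)

lemma wpow_append:
  assumes "wequiv R (u @ v) (v @ u)"
  shows "wequiv R (wpow u k @ wpow v k) (wpow (u @ v) k)"
proof (rule wpow_unique)
  fix j
  have "wequiv R (wpow u (j + 1) @ wpow v (j + 1)) ((u @ wpow u j) @ (v @ wpow v j))"
    by (intro wequiv_append wpow_add1)
  also have "wequiv R \<dots> (u @ (v @ wpow u j) @ wpow v j)"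
    using wequiv_ctx[OF wequiv.sym[OF wequiv_commute_wpow[OF wequiv.sym[OF assms]]], of u j "wpow v j"]
    by simp
  finally show "wequiv R (wpow u (j + 1) @ wpow v (j + 1)) ((u @ v) @ wpow u j @ wpow v j)"
    by simp
qed (simp add: wequiv.refl)

subsection \<open>Actions of words\<close>

text \<open>Folding from the right makes the leftmost letter act last, so words act like left
  multiplication on normal forms.\<close>

definition run :: "(letter \<Rightarrow> 's \<Rightarrow> 's) \<Rightarrow> word \<Rightarrow> 's \<Rightarrow> 's" where
  "run f w = foldr f w"

lemma run_simps [simp]:
  "run f [] s = s" "run f (x # w) s = f x (run f w s)" "run f (u @ v) s = run f u (run f v s)"
  by (simp_all add: run_def)

lemma run_in:
  assumes "\<And>x s. s \<in> S \<Longrightarrow> f x s \<in> S" "s \<in> S"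
  shows "run f w s \<in> S"
  using assms by (induction w) auto

lemma run_winv:
  assumes "\<And>x s. s \<in> S \<Longrightarrow> f x s \<in> S" "\<And>x s. s \<in> S \<Longrightarrow> f x (f (linv x) s) = s" "s \<in> S"
  shows "run f w (run f (winv w) s) = s"
  using assms(3)
proof (induction w arbitrary: s)
  case (Cons x w)
  then show ?case using assms by (simp add: winv_def)
qed (simp add: winv_def)

text \<open>Each generating step of \<open>wequiv\<close> preserves the action. The set S singles
  out the valid states, where the letters act invertibly.\<close>

lemma run_wequiv:
  assumes closed: "\<And>x s. s \<in> S \<Longrightarrow> f x s \<in> S"
    and inverse: "\<And>x s. s \<in> S \<Longrightarrow> f x (f (linv x) s) = s"
    and rels: "\<And>r s. r \<in> R \<Longrightarrow> s \<in> S \<Longrightarrow> run f r s = s"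
    and "wequiv R u v" "s \<in> S"
  shows "run f u s = run f v s"
  using assms(4,5)
proof (induction arbitrary: s rule: wequiv.induct)
  case (cancel u x v)
  then show ?case using inverse run_in[of S f, OF closed] by simp
next
  case (rel r u v)
  then show ?case using rels run_in[of S f, OF closed] by simp
qed simp_all

lemma run_comm:
  assumes closed: "\<And>x s. s \<in> S \<Longrightarrow> f x s \<in> S"
    and inverse: "\<And>x s. s \<in> S \<Longrightarrow> f x (f (linv x) s) = s"
    and commute: "\<And>s. s \<in> S \<Longrightarrow> run f (u @ v) s = run f (v @ u) s"
    and "s \<in> S"
  shows "run f (comm u v) s = s"
proof -
  \<comment> \<open>Letting the two inverse factors of the commutator act first leaves a comparison
    of \<open>u @ v\<close> with \<open>v @ u\<close> at the state t.\<close>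
  define t where "t = run f (winv (v @ u)) s"
  have "t \<in> S" unfolding t_def by (rule run_in[of S f, OF closed \<open>s \<in> S\<close>])
  have "run f (comm u v) s = run f (u @ v) t"
    by (simp add: comm_def t_def)
  also have "\<dots> = run f (v @ u) t"
    by (rule commute[OF \<open>t \<in> S\<close>])
  also have "\<dots> = s"
    unfolding t_def by (rule run_winv[of S f, OF closed inverse \<open>s \<in> S\<close>])
  finally show ?thesis .
qed

text \<open>T is a guessed two-sided orbit of s; checking one step forwards and one backwards
  confirms it.\<close>

lemma run_wpow:
  assumes zero: "T 0 = s"
    and pos: "\<And>k::int. run f w (T k) = T (k + 1)"
    and neg: "\<And>k::int. run f (winv w) (T k) = T (k - 1)"
  shows "run f (wpow w k) s = T k"
proof -
  have "run f (wpow_nat w n) s = T (int n)" for n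
    by (induction n) (simp_all only: wpow_nat.simps run_simps pos zero of_nat_Suc of_nat_0 add.commute)
  moreover have "run f (wpow_nat (winv w) n) s = T (- int n)" for n
  proof (induction n)
    case (Suc n)
    then show ?case using neg[of "- int n"] by (simp add: minus_diff_commute)
  qed (simp add: zero)
  ultimately show ?thesis by (simp add: wpow_def)
qed

subsection \<open>Independence of the relators\<close>

text \<open>The lamplighter action on a configuration x, extended by a counter z that records how often
  the generator b meets the lamp at distance k: it separates exactly the k-th relator.\<close>

fun lamp_step :: "int \<Rightarrow> letter \<Rightarrow> (int \<Rightarrow> int) \<times> int \<Rightarrow> (int \<Rightarrow> int) \<times> int" where
  "lamp_step k (GA, s) (x, z) = ((\<lambda>i. x (if s then i + 1 else i - 1)), z)"
| "lamp_step k (GB, s) (x, z) =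
     (x(0 := x 0 + (if s then - 1 else 1)), z + (if s then - x k else x k))"

text \<open>The letter b alters only lamp 0, and k > 0, so the lamp added to the counter has the
  same value before and after b acts.\<close>

lemma lamp_step_inverse:
  assumes "k > 0"
  shows "lamp_step k x (lamp_step k (linv x) s) = s"
proof (cases x)
  case (Pair g e)
  then show ?thesis using assms by (cases g; cases s) (auto simp: linv_def)
qed

lemma run_lamp_b:
  assumes "k > 0"
  shows "run (lamp_step k) (wpow wb j) (x, z) = (x(0 := x 0 + j), z + j * x k)"
  by (rule run_wpow) (use assms in \<open>auto simp: wb_def winv_def linv_def algebra_simps\<close>)

lemma run_lamp_a: "run (lamp_step k) (wpow wa j) (x, z) = ((\<lambda>i. x (i - j)), z)"
  by (rule run_wpow) (auto simp: wa_def winv_def linv_def algebra_simps)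

lemma run_lamp_conj:
  assumes "k > 0"
  shows "run (lamp_step k) (wpow wa i @ wpow wb m @ wpow wa (- i)) (x, z) =
    (x(i := x i + m), z + m * x (k + i))"
  using assms by (auto simp: run_lamp_a run_lamp_b fun_eq_iff)

text \<open>If the conjugate acts first, it raises lamp i by m before b reads lamp k. If b acts
  first, the conjugate reads lamp k + i, which b has left alone. The counters therefore differ by m
  exactly if i = k.\<close>

lemma run_lamp_commute:
  assumes "k > 0" "i > 0" "m \<noteq> 0"
  shows "run (lamp_step k) (wb @ wpow wa i @ wpow wb m @ wpow wa (- i)) (x, z) =
      run (lamp_step k) ((wpow wa i @ wpow wb m @ wpow wa (- i)) @ wb) (x, z) \<longleftrightarrow> i \<noteq> k"
proof -
  have b: "run (lamp_step k) wb (y, t) = (y(0 := y 0 + 1), t + y k)" for y t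
    using run_lamp_b[OF assms(1), of 1 y t] by simp
  show ?thesis
    unfolding run_simps(3)[of _ wb] run_simps(3)[of _ "wpow wa i @ wpow wb m @ wpow wa (- i)"]
    using assms by (auto simp only: run_lamp_conj b) (auto simp: fun_eq_iff)
qed

text \<open>All relators except the k-th act trivially on lamp states, so the lamp machine is an
  action of the group they present; the two sides of the k-th relation act differently.\<close>

lemma conj_relators_independent:
  assumes "m \<noteq> 0" "k \<ge> 1"
  shows "comm wb (wpow wa (int k) @ wpow wb m @ wpow wa (- int k))
    \<notin> presented {comm wb (wpow wa (int i) @ wpow wb m @ wpow wa (- int i)) | i. i \<ge> 1 \<and> i \<noteq> k}"
    (is "comm wb (?c k) \<notin> presented ?R")
proof
  assume "comm wb (?c k) \<in> presented ?R"
  then have eq: "wequiv ?R (wb @ ?c k) (?c k @ wb)"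
    by (simp add: presented_def wequiv_comm_iff)
  have inverse: "lamp_step (int k) x (lamp_step (int k) (linv x) s) = s" for x s
    using assms(2) by (intro lamp_step_inverse) simp
  have rels: "run (lamp_step (int k)) r s = s" if r: "r \<in> ?R" for r s
  proof -
    obtain i where i: "r = comm wb (?c i)" "i \<ge> 1" "i \<noteq> k" using r by blast
    have "run (lamp_step (int k)) (wb @ ?c i) t = run (lamp_step (int k)) (?c i @ wb) t" for t
      using run_lamp_commute[of "int k" "int i" m "fst t" "snd t"] assms i by simp
    then show ?thesis
      unfolding i(1) by (intro run_comm[where S = UNIV] inverse) simp_all
  qed
  have "run (lamp_step (int k)) (wb @ ?c k) (\<lambda>_. 0, 0) = run (lamp_step (int k)) (?c k @ wb) (\<lambda>_. 0, 0)"
    by (rule run_wequiv[OF _ inverse rels eq, of UNIV]) simp_all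
  then show False
    using run_lamp_commute[of "int k" "int k" m] assms by simp
qed

subsection \<open>Normal form machines\<close>

text \<open>A state \<open>(e, [(s1, i1), (s2, i2), \<dots>])\<close> stands for the normal form
  \<open>e a\<^sup>\<plusminus> b\<^sup>i\<^sup>1 a\<^sup>\<plusminus> b\<^sup>i\<^sup>2 \<dots>\<close> in an HNN extension with stable letter a, where e lies in the
  base group and the flag True encodes the inverse of a. The map sp writes \<open>a\<^sup>\<plusminus> e\<close> as
  \<open>e' a\<^sup>\<plusminus> b\<^sup>i\<close>, and sh j is multiplication by the j-th power of b.\<close>

fun mstep :: "(bool \<Rightarrow> 'e \<Rightarrow> int \<times> 'e) \<Rightarrow> (int \<Rightarrow> 'e \<Rightarrow> 'e) \<Rightarrow> letter
    \<Rightarrow> 'e \<times> (bool \<times> int) list \<Rightarrow> 'e \<times> (bool \<times> int) list" where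
  "mstep sp sh (GB, s) (e, L) = (sh (if s then - 1 else 1) e, L)"
| "mstep sp sh (GA, s) (e, L) = (case sp s e of (i, e') \<Rightarrow>
     if i = 0 \<and> L \<noteq> [] \<and> fst (hd L) \<noteq> s then (sh (snd (hd L)) e', tl L)
     else (e', (s, i) # L))"

text \<open>Symmetric remainders are used because they do not depend on the modulus once it is large.\<close>

definition crem :: "int \<Rightarrow> int \<Rightarrow> int" where
  "crem x d = (x + \<bar>d\<bar> div 2) mod \<bar>d\<bar> - \<bar>d\<bar> div 2"

lemma crem_add_mult [simp]: "crem (x + d * y) d = crem x d"
proof -
  have "(x + d * y + \<bar>d\<bar> div 2) = (x + \<bar>d\<bar> div 2) + \<bar>d\<bar> * (sgn d * y)"
    by (simp add: mult.assoc[symmetric] abs_mult_sgn)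
  then show ?thesis unfolding crem_def by (simp only: mod_mult_self2)
qed

lemma dvd_diff_crem: "d dvd x - crem x d"
proof -
  have "x - crem x d = (x + \<bar>d\<bar> div 2) - (x + \<bar>d\<bar> div 2) mod \<bar>d\<bar>"
    by (simp add: crem_def)
  then have "\<bar>d\<bar> dvd x - crem x d"
    by (simp only: dvd_minus_mod)
  then show ?thesis by simp
qed

lemma mult_div_crem [simp]: "d * ((x - crem x d) div d) = x - crem x d"
  by (rule dvd_mult_div_cancel[OF dvd_diff_crem])

lemma crem_crem [simp]: "crem (crem x d) d = crem x d"
  using crem_add_mult[of "crem x d" d "(x - crem x d) div d"] by simp

lemma crem_0 [simp]: "crem 0 d = 0"
  by (cases "d = 0") (auto simp: crem_def)

lemma crem_small:
  assumes "2 * \<bar>x\<bar> + 1 < \<bar>d\<bar>"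
  shows "crem x d = x"
proof -
  have "(x + \<bar>d\<bar> div 2) mod \<bar>d\<bar> = x + \<bar>d\<bar> div 2"
    using assms by (intro mod_pos_pos_trivial) linarith+
  then show ?thesis by (simp add: crem_def)
qed

text \<open>In \<open>BS m q\<close> one has \<open>a b\<^sup>m = b\<^sup>q a\<close>.\<close>

definition bs_mod :: "int \<Rightarrow> int \<Rightarrow> bool \<Rightarrow> int" where
  "bs_mod m q s = (if s then q else m)"

text \<open>Powers of \<open>b^m\<close> cross a as powers of \<open>b^q\<close>, and the reverse
  holds for the inverse of a. The remainder i stays to the right of the stable letter; the quotient
  moves to its left with the opposite exponent.\<close>

definition bs_split :: "int \<Rightarrow> int \<Rightarrow> bool \<Rightarrow> int \<Rightarrow> int \<times> int" where
  "bs_split m q s N = (let d = bs_mod m q s; i = crem N d in (i, bs_mod m q (\<not> s) * ((N - i) div d)))"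

abbreviation bs_step :: "int \<Rightarrow> int \<Rightarrow> letter \<Rightarrow> int \<times> (bool \<times> int) list \<Rightarrow> int \<times> (bool \<times> int) list" where
  "bs_step m q \<equiv> mstep (bs_split m q) (+)"

text \<open>These are the HNN normal form conditions: chosen coset representatives after each stable
  letter, and no a next to its inverse.\<close>

fun bs_reduced :: "int \<Rightarrow> int \<Rightarrow> (bool \<times> int) list \<Rightarrow> bool" where
  "bs_reduced m q [] = True"
| "bs_reduced m q ((s, i) # L) \<longleftrightarrow> crem i (bs_mod m q s) = i \<and>
     (i = 0 \<longrightarrow> L = [] \<or> fst (hd L) = s) \<and> bs_reduced m q L"

lemma bs_step_reduced:
  assumes "bs_reduced m q (snd S)"
  shows "bs_reduced m q (snd (bs_step m q x S))"
proof -
  obtain g s N L where [simp]: "x = (g, s)" "S = (N, L)" by fastforce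
  show ?thesis
    using assms by (cases g; cases L) (auto simp: bs_split_def Let_def)
qed

lemma bs_step_inverse:
  assumes "bs_reduced m q (snd S)" "m \<noteq> 0" "q \<noteq> 0"
  shows "bs_step m q x (bs_step m q (linv x) S) = S"
proof -
  obtain g s N L where x: "x = (g, s)" and S: "S = (N, L)" by fastforce
  show ?thesis
  proof (cases g)
    case GB
    then show ?thesis by (simp add: x S linv_def)
  next
    case GA
    define d d' where "d = bs_mod m q (\<not> s)" and "d' = bs_mod m q s"
    define k where "k = (N - crem N d) div d"
    have "d \<noteq> 0" "d' \<noteq> 0" using assms by (auto simp: d_def d'_def bs_mod_def)
    have k: "d * k = N - crem N d" by (simp add: k_def)
    have crem_mult: "crem (d' * y) d' = 0" for y
      using crem_add_mult[of 0 d' y] by simp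
    have split: "bs_split m q (\<not> s) N = (crem N d, d' * k)"
      by (simp add: bs_split_def Let_def d_def d'_def k_def)
    have split': "bs_split m q s (i + d' * y) = (i, d * y)" if "crem i d' = i" for i y
      using that \<open>d' \<noteq> 0\<close> by (simp add: bs_split_def Let_def d_def[symmetric] d'_def[symmetric])
    show ?thesis
    \<comment> \<open>Either the letter acting first cancels the head of L and the second restores
      it, reducedness of the tail excluding a further cancellation; or the first is pushed and the
      second, meeting remainder 0, cancels it.\<close>
    proof (cases "crem N d = 0 \<and> L \<noteq> [] \<and> fst (hd L) = s")
      case True
      then obtain i L' where L: "L = (s, i) # L'" by (cases L) auto
      have i: "crem i d' = i" "i = 0 \<longrightarrow> L' = [] \<or> fst (hd L') = s"
        using assms(1) by (auto simp: S L d'_def)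
      show ?thesis
        using True i k by (auto simp: x S L GA linv_def split split')
    next
      case False
      have "bs_split m q s (d' * k) = (0, d * k)"
        using split'[of 0 k] by simp
      then show ?thesis
        using False k by (auto simp: x S GA linv_def split)
    qed
  qed
qed

lemma run_bs_b: "run (bs_step m q) (wpow wb j) (N, L) = (N + j, L)"
  by (rule run_wpow) (auto simp: wb_def winv_def linv_def)

lemma run_bs_relator:
  assumes "bs_reduced m q (snd S)" "m \<noteq> 0" "q \<noteq> 0"
  shows "run (bs_step m q) (wa @ wpow wb m @ winv wa @ wpow wb (- q)) S = S"
proof -
  \<comment> \<open>The identity \<open>a b^m = b^q a\<close> on states: adding m keeps the
    remainder and raises the quotient by one, which adds q to the result.\<close>
  have shift: "bs_step m q (GA, False) (N + m, L) =
      apfst ((+) q) (bs_step m q (GA, False) (N, L))" for N L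
  proof -
    have c: "crem (N + m) m = crem N m" using crem_add_mult[of N m 1] by simp
    have "N + m - crem N m = (N - crem N m) + m" by simp
    then have "(N + m - crem N m) div m = (N - crem N m) div m + 1"
      by (simp only: div_add_self2[OF assms(2)])
    then show ?thesis
      by (simp add: bs_split_def Let_def bs_mod_def c algebra_simps)
  qed
  obtain N L where S: "S = (N, L)" by fastforce
  obtain N' L' where S': "bs_step m q (GA, True) (N - q, L) = (N', L')" by fastforce
  have "bs_step m q (GA, False) (N', L') = (N - q, L)"
    using bs_step_inverse[of m q "(N - q, L)" "(GA, False)"] assms S S' by (simp add: linv_def)
  then show ?thesis
    using run_bs_b[of m q "- q" N L] S' shift[of N' L'] run_bs_b[of m q m N' L']
    by (simp add: S wa_def winv_def linv_def)
qed

lemma run_bs_trivial: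
  assumes "w \<in> BS m q" "m \<noteq> 0" "q \<noteq> 0"
  shows "run (bs_step m q) w (0, []) = (0, [])"
proof -
  have "run (bs_step m q) w (0, []) = run (bs_step m q) [] (0, [])"
  proof (rule run_wequiv[where S = "{S. bs_reduced m q (snd S)}"])
    show "wequiv {wa @ wpow wb m @ winv wa @ wpow wb (- q)} w []"
      using assms(1) by (simp add: BS_def presented_def)
  qed (use assms bs_step_reduced bs_step_inverse run_bs_relator in auto)
  then show ?thesis by simp
qed

subsection \<open>The limit machine\<close>

text \<open>The pair \<open>(c, [e1, e2, \<dots>])\<close> encodes \<open>b\<^sup>c b1\<^sup>e\<^sup>1 b2\<^sup>e\<^sup>2 \<dots>\<close> in the free abelian base of the limit
  group; \<open>\<rho> k\<close> plays the role of the remainder of index k + 1. Conjugation by a sends \<open>b\<^sup>m\<close> to b1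
  and \<open>b\<^sub>k b\<^sup>-\<^sup>\<rho>\<close> to the next generator.\<close>

fun rdot :: "(nat \<Rightarrow> int) \<Rightarrow> nat \<Rightarrow> int list \<Rightarrow> int" where
  "rdot \<rho> k [] = 0"
| "rdot \<rho> k (e # es) = e * \<rho> k + rdot \<rho> (Suc k) es"

text \<open>For a, each \<open>b_k\<close> is written as \<open>b^\<rho>\<close> times
  \<open>b_k b^-\<rho>\<close>: the first factors join \<open>b^c\<close> into \<open>b^N\<close>,
  whose multiple of m becomes a power of \<open>b_1\<close>, and the second factors shift up by one
  index. The inverse of a undoes this on \<open>b_1, b_2, ...\<close> and leaves all of
  \<open>b^c\<close> behind.\<close>

fun lim_split :: "int \<Rightarrow> (nat \<Rightarrow> int) \<Rightarrow> bool \<Rightarrow> int \<times> int list \<Rightarrow> int \<times> int \<times> int list" where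
  "lim_split m \<rho> False (c, es) = (let N = c + rdot \<rho> 0 es; i = crem N m in (i, 0, (N - i) div m # es))"
| "lim_split m \<rho> True (c, []) = (c, 0, [])"
| "lim_split m \<rho> True (c, t # es) = (c, m * t - rdot \<rho> 0 es, es)"

definition lim_shift :: "int \<Rightarrow> int \<times> int list \<Rightarrow> int \<times> int list" where
  "lim_shift j e = (j + fst e, snd e)"

abbreviation lim_step :: "int \<Rightarrow> (nat \<Rightarrow> int) \<Rightarrow> letter
    \<Rightarrow> (int \<times> int list) \<times> (bool \<times> int) list \<Rightarrow> (int \<times> int list) \<times> (bool \<times> int) list" where
  "lim_step m \<rho> \<equiv> mstep (lim_split m \<rho>) lim_shift"

text \<open>In \<open>BS m q\<close> the generator of index k + 1 becomes the power \<open>q * quot m \<rho> q k\<close> of b, as long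
  as the divisions are exact.\<close>

fun quot :: "int \<Rightarrow> (nat \<Rightarrow> int) \<Rightarrow> int \<Rightarrow> nat \<Rightarrow> int" where
  "quot m \<rho> q 0 = 1"
| "quot m \<rho> q (Suc k) = (q * quot m \<rho> q k - \<rho> k) div m"

definition quot_exact :: "int \<Rightarrow> (nat \<Rightarrow> int) \<Rightarrow> int \<Rightarrow> nat \<Rightarrow> bool" where
  "quot_exact m \<rho> q h \<longleftrightarrow> (\<forall>k<h. m * quot m \<rho> q (Suc k) = q * quot m \<rho> q k - \<rho> k)"

fun qdot :: "int \<Rightarrow> (nat \<Rightarrow> int) \<Rightarrow> int \<Rightarrow> nat \<Rightarrow> int list \<Rightarrow> int" where
  "qdot m \<rho> q k [] = 0"
| "qdot m \<rho> q k (e # es) = e * quot m \<rho> q k + qdot m \<rho> q (Suc k) es"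

definition lim_val :: "int \<Rightarrow> (nat \<Rightarrow> int) \<Rightarrow> int \<Rightarrow> int \<times> int list \<Rightarrow> int" where
  "lim_val m \<rho> q e = fst e + q * qdot m \<rho> q 0 (snd e)"

text \<open>The exactness recursion of \<open>quot\<close>, summed over a list of exponents; the
  length bound keeps all indices below h.\<close>

lemma mult_qdot_Suc:
  assumes "quot_exact m \<rho> q h" "k + length es \<le> h"
  shows "m * qdot m \<rho> q (Suc k) es = q * qdot m \<rho> q k es - rdot \<rho> k es"
  using assms(2)
proof (induction es arbitrary: k)
  case (Cons e es)
  have "m * quot m \<rho> q (Suc k) = q * quot m \<rho> q k - \<rho> k"
    using assms(1) Cons.prems by (simp add: quot_exact_def)
  then have "m * (e * quot m \<rho> q (Suc k)) = e * (q * quot m \<rho> q k - \<rho> k)"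
    by (metis mult.left_commute)
  moreover have "m * qdot m \<rho> q (Suc (Suc k)) es = q * qdot m \<rho> q (Suc k) es - rdot \<rho> (Suc k) es"
    using Cons by simp
  ultimately show ?case
    unfolding qdot.simps(2) rdot.simps(2) distrib_left by (simp only:) (simp add: algebra_simps)
qed simp

text \<open>Evaluation intertwines the two splittings. For a, the list contributes its
  \<open>rdot\<close> plus a multiple of m, so both machines find the same remainder. For the
  inverse of a, the value is c plus a multiple of q, and c is small enough to be its own remainder
  modulo q.\<close>

lemma bs_split_lim_val:
  assumes "m \<noteq> 0" "quot_exact m \<rho> q (length (snd e))" "2 * \<bar>fst e\<bar> + 1 < \<bar>q\<bar>"
  shows "bs_split m q s (lim_val m \<rho> q e) = apsnd (lim_val m \<rho> q) (lim_split m \<rho> s e)"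
proof -
  obtain c es where e: "e = (c, es)" by fastforce
  have "q \<noteq> 0" using assms(3) by auto
  show ?thesis
  proof (cases s)
    case False
    define N i where "N = c + rdot \<rho> 0 es" and "i = crem N m"
    have val: "lim_val m \<rho> q e = N + m * qdot m \<rho> q (Suc 0) es"
      using mult_qdot_Suc[OF assms(2), of 0 es] by (simp add: lim_val_def e N_def)
    have "N + m * qdot m \<rho> q (Suc 0) es - i = m * ((N - i) div m + qdot m \<rho> q (Suc 0) es)"
      by (simp add: i_def distrib_left)
    then have "(N + m * qdot m \<rho> q (Suc 0) es - i) div m = (N - i) div m + qdot m \<rho> q (Suc 0) es"
      using assms(1) by simp
    then have "bs_split m q s (lim_val m \<rho> q e) = (i, q * ((N - i) div m + qdot m \<rho> q (Suc 0) es))"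
      unfolding val bs_split_def bs_mod_def Let_def using False by (simp add: i_def)
    moreover have "lim_split m \<rho> s e = (i, 0, (N - i) div m # es)"
      using False by (simp add: e Let_def N_def i_def)
    ultimately show ?thesis by (simp add: lim_val_def)
  next
    case True
    have small: "crem (c + q * y) q = c" for y
      using assms(3) by (simp add: crem_small e)
    show ?thesis
    proof (cases es)
      case Nil
      then show ?thesis
        using small[of 0] True by (simp add: e bs_split_def bs_mod_def lim_val_def Let_def)
    next
      case (Cons t fs)
      have "m * qdot m \<rho> q (Suc 0) fs = q * qdot m \<rho> q 0 fs - rdot \<rho> 0 fs"
        using assms(2) by (intro mult_qdot_Suc) (auto simp: e Cons)
      then show ?thesis
        using True \<open>q \<noteq> 0\<close> small[of 0]
        by (simp add: e Cons bs_split_def bs_mod_def lim_val_def Let_def distrib_left[of m])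
    qed
  qed
qed

text \<open>The filter F expresses that q tends to the m-adic limit while its absolute value grows,
  without choosing a sequence.\<close>

locale approximation =
  fixes m :: int and \<rho> :: "nat \<Rightarrow> int" and F :: "int filter"
  assumes m: "m \<noteq> 0"
    and large: "\<And>B. eventually (\<lambda>q. B < \<bar>q\<bar>) F"
    and exact: "\<And>h. eventually (\<lambda>q. quot_exact m \<rho> q h) F"
begin

lemma eventually_step:
  "eventually (\<lambda>q. bs_step m q x (apfst (lim_val m \<rho> q) S) = apfst (lim_val m \<rho> q) (lim_step m \<rho> x S)) F"
proof -
  obtain g s e L where x: "x = (g, s)" and S: "S = (e, L)" by fastforce
  have shift: "lim_val m \<rho> q (lim_shift j e) = j + lim_val m \<rho> q e" for q j e
    by (simp add: lim_val_def lim_shift_def)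
  show ?thesis
  proof (cases g)
    case GB
    then show ?thesis by (simp add: x S shift)
  next
    case GA
    show ?thesis
      using large[of "2 * \<bar>fst e\<bar> + 1"] exact[of "length (snd e)"]
    proof eventually_elim
      case (elim q)
      show ?case
        by (cases "lim_split m \<rho> s e")
          (simp add: x S GA bs_split_lim_val[OF m elim(2,1)] shift)
    qed
  qed
qed

text \<open>A word visits finitely many limit states, and each step asks of q only one size bound
  and one depth of exactness.\<close>

lemma eventually_run:
  "eventually (\<lambda>q. run (bs_step m q) w (0, []) =
     apfst (lim_val m \<rho> q) (run (lim_step m \<rho>) w ((0, []), []))) F"
proof (induction w)
  case Nil
  show ?case by (simp add: lim_val_def)
next
  case (Cons x w)
  then show ?case using eventually_step[of x "run (lim_step m \<rho>) w ((0, []), [])"]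
    by eventually_elim simp
qed

text \<open>A large q cannot divide a nonzero c. If c = 0, the value is q times a sum, and m times
  that sum is again a \<open>lim_val\<close>, of a nonzero vector with a shorter list; induction
  applies.\<close>

lemma eventually_lim_val_nonzero:
  assumes "c \<noteq> 0 \<or> (\<exists>e\<in>set es. e \<noteq> 0)"
  shows "eventually (\<lambda>q. lim_val m \<rho> q (c, es) \<noteq> 0) F"
  using assms
proof (induction es arbitrary: c)
  case Nil
  then show ?case by (simp add: lim_val_def)
next
  case (Cons t fs)
  show ?case
  proof (cases "c = 0")
    case False
    from large[of "\<bar>c\<bar>"] show ?thesis
    proof eventually_elim
      case (elim q)
      show ?case
      proof
        assume "lim_val m \<rho> q (c, t # fs) = 0"
        then have "c = q * - qdot m \<rho> q 0 (t # fs)"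
          by (simp only: lim_val_def fst_conv snd_conv)
        then have "q dvd c" by (rule dvdI)
        then show False using dvd_imp_le_int[OF False] elim by fastforce
      qed
    qed
  next
    case True
    let ?c = "m * t - rdot \<rho> 0 fs"
    have "?c \<noteq> 0 \<or> (\<exists>e\<in>set fs. e \<noteq> 0)"
    proof (rule ccontr)
      assume "\<not> ?thesis"
      then have c0: "?c = 0" and fs0: "\<forall>e\<in>set fs. e = 0" by blast+
      from fs0 have "rdot \<rho> k fs = 0" for k by (induction fs arbitrary: k) auto
      with c0 have "m * t = 0" by simp
      then show False using Cons.prems True fs0 m by simp
    qed
    then have "eventually (\<lambda>q. lim_val m \<rho> q (?c, fs) \<noteq> 0) F"
      by (rule Cons.IH)
    then show ?thesis
      using exact[of "length fs"] large[of 0]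
    proof eventually_elim
      case (elim q)
      have "lim_val m \<rho> q (?c, fs) = m * (t + qdot m \<rho> q (Suc 0) fs)"
        using mult_qdot_Suc[OF elim(2), of 0 fs] by (simp add: lim_val_def distrib_left)
      then show ?case using elim(1,3) True by (auto simp: lim_val_def)
    qed
  qed
qed

end

subsection \<open>The words represented by the limit machine\<close>

lemma winv_wa: "winv wa = [(GA, True)]" and winv_wb: "winv wb = [(GB, True)]"
  by (simp_all add: wa_def wb_def winv_def linv_def)

fun tail_word :: "int \<Rightarrow> (nat \<Rightarrow> int) \<Rightarrow> nat \<Rightarrow> int list \<Rightarrow> word" where
  "tail_word m \<xi> k [] = []"
| "tail_word m \<xi> k (e # es) = wpow (bword m \<xi> (Suc k)) e @ tail_word m \<xi> (Suc k) es"

definition base_word :: "int \<Rightarrow> (nat \<Rightarrow> int) \<Rightarrow> int \<times> int list \<Rightarrow> word" where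
  "base_word m \<xi> e = wpow wb (fst e) @ tail_word m \<xi> 0 (snd e)"

fun stable_word :: "(bool \<times> int) list \<Rightarrow> word" where
  "stable_word [] = []"
| "stable_word ((s, i) # L) = [(GA, s)] @ wpow wb i @ stable_word L"

definition state_word :: "int \<Rightarrow> (nat \<Rightarrow> int) \<Rightarrow> (int \<times> int list) \<times> (bool \<times> int) list \<Rightarrow> word" where
  "state_word m \<xi> S = base_word m \<xi> (fst S) @ stable_word (snd S)"

text \<open>As b commutes with \<open>b_{k+1}\<close>, the power e distributes over the product that
  a conjugates into \<open>b_{k+2}\<close>.\<close>

lemma wpow_bword_Suc:
  assumes "wequiv R (wb @ bword m \<xi> (Suc k)) (bword m \<xi> (Suc k) @ wb)"
  shows "wequiv R (wa @ wpow (bword m \<xi> (Suc k)) e @ wpow wb (- (e * r_fun m \<xi> (Suc k))) @ winv wa)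
    (wpow (bword m \<xi> (Suc (Suc k))) e)"
proof -
  let ?B = "bword m \<xi> (Suc k)" and ?r = "r_fun m \<xi> (Suc k)"
  have "wequiv R (wpow wb (- (e * ?r))) (wpow (wpow wb (- ?r)) e)"
    using wpow_mult[of R wb "- ?r" e] by (simp add: mult.commute)
  then have "wequiv R (wpow ?B e @ wpow wb (- (e * ?r))) (wpow ?B e @ wpow (wpow wb (- ?r)) e)"
    by (rule wequiv_append_left)
  also have "wequiv R \<dots> (wpow (?B @ wpow wb (- ?r)) e)"
    by (intro wpow_append wequiv_commute_wpow wequiv.sym[OF assms])
  finally have "wequiv R (wa @ (wpow ?B e @ wpow wb (- (e * ?r))) @ winv wa)
      (wa @ wpow (?B @ wpow wb (- ?r)) e @ winv wa)"
    by (rule wequiv_ctx)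
  also have "wequiv R \<dots> (wpow (wa @ (?B @ wpow wb (- ?r)) @ winv wa) e)"
    by (rule wpow_conj)
  finally show ?thesis by simp
qed

text \<open>The factors of a base word keep increasing index order throughout the rewriting, so only
  powers of b ever have to be moved past them.\<close>

locale commuting_relators =
  fixes R :: "word set" and m :: int and \<xi> :: "nat \<Rightarrow> int"
  assumes commute: "\<And>k. wequiv R (wb @ bword m \<xi> (Suc k)) (bword m \<xi> (Suc k) @ wb)"
begin

abbreviation rho :: "nat \<Rightarrow> int" where
  "rho k \<equiv> r_fun m \<xi> (Suc k)"

lemma tail_word_commute:
  "wequiv R (wpow wb j @ tail_word m \<xi> k es) (tail_word m \<xi> k es @ wpow wb j)"
proof (induction es arbitrary: k)
  case Nil
  show ?case by (simp add: wequiv.refl)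
next
  case (Cons e es)
  let ?B = "wpow (bword m \<xi> (Suc k)) e" and ?T = "tail_word m \<xi> (Suc k) es"
  have "wequiv R ((wpow wb j @ ?B) @ ?T) ((?B @ wpow wb j) @ ?T)"
    by (intro wequiv_append_right wequiv_commute_wpow_wpow commute)
  also have "wequiv R ((?B @ wpow wb j) @ ?T) (?B @ ?T @ wpow wb j)"
    using wequiv_append_left[OF Cons.IH] by simp
  finally show ?case by simp
qed

text \<open>The total power of b is distributed among the factors, each \<open>b_k\<close> receiving
  its own \<open>b^-\<rho>\<close>; conjugation by a then raises every index by one.\<close>

lemma tail_word_conj:
  "wequiv R (wa @ tail_word m \<xi> k es @ wpow wb (- rdot rho k es) @ winv wa) (tail_word m \<xi> (Suc k) es)"
proof (induction es arbitrary: k)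
  case Nil
  show ?case by (simp add: wequiv_winv_right)
next
  case (Cons e es)
  let ?B = "wpow (bword m \<xi> (Suc k)) e" and ?T = "tail_word m \<xi> (Suc k) es"
  let ?r = "wpow wb (- (e * rho k))" and ?d = "wpow wb (- rdot rho (Suc k) es)"
  have "wequiv R (wpow wb (- (e * rho k + rdot rho (Suc k) es))) (?r @ ?d)"
    using wpow_add[of R wb "- (e * rho k)" "- rdot rho (Suc k) es"] by simp
  then have "wequiv R ((wa @ ?B @ ?T) @ wpow wb (- (e * rho k + rdot rho (Suc k) es)) @ winv wa)
      ((wa @ ?B @ ?T) @ (?r @ ?d) @ winv wa)"
    by (rule wequiv_ctx)
  also have "wequiv R \<dots> ((wa @ ?B) @ (?r @ ?T) @ (?d @ winv wa))"
    using wequiv_ctx[OF wequiv.sym[OF tail_word_commute], of "wa @ ?B" "Suc k" es "- (e * rho k)" "?d @ winv wa"]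
    by simp
  also have "wequiv R \<dots> ((wa @ ?B @ ?r) @ winv wa @ wa @ (?T @ ?d @ winv wa))"
    using wequiv.sym[OF wequiv_winv_left_ctx[of R "wa @ ?B @ ?r" wa "?T @ ?d @ winv wa"]] by simp
  also have "wequiv R \<dots> (wpow (bword m \<xi> (Suc (Suc k))) e @ tail_word m \<xi> (Suc (Suc k)) es)"
    using wequiv_append[OF wpow_bword_Suc[OF commute] Cons.IH] by simp
  finally show ?case by simp
qed

text \<open>The identity behind both cases of \<open>lim_split\<close>: \<open>b_1^t\<close> is the
  conjugate of \<open>b^(m t)\<close>, and the remaining factors come from
  \<open>tail_word_conj\<close>.\<close>

lemma tail_word_Cons_conj:
  "wequiv R (tail_word m \<xi> 0 (t # es))
     (wa @ wpow wb (m * t - rdot rho 0 es) @ tail_word m \<xi> 0 es @ winv wa)"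
proof -
  let ?T = "tail_word m \<xi> 0 es" and ?d = "- rdot rho 0 es"
  have "wequiv R (wa @ wpow wb (m * t) @ winv wa) (wa @ wpow (wpow wb m) t @ winv wa)"
    by (rule wequiv_ctx[OF wpow_mult])
  also have "wequiv R \<dots> (wpow (bword m \<xi> (Suc 0)) t)"
    using wpow_conj[of R wa "wpow wb m" t] by simp
  finally have b1: "wequiv R (wpow (bword m \<xi> (Suc 0)) t) (wa @ wpow wb (m * t) @ winv wa)"
    by (rule wequiv.sym)
  have "wequiv R (tail_word m \<xi> 0 (t # es))
      ((wa @ wpow wb (m * t) @ winv wa) @ (wa @ ?T @ wpow wb ?d @ winv wa))"
    using wequiv_append[OF b1 wequiv.sym[OF tail_word_conj[of 0 es]]] by simp
  also have "wequiv R \<dots> ((wa @ wpow wb (m * t)) @ (?T @ wpow wb ?d) @ winv wa)"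
    using wequiv_winv_left_ctx[of R "wa @ wpow wb (m * t)" wa "?T @ wpow wb ?d @ winv wa"] by simp
  also have "wequiv R \<dots> ((wa @ wpow wb (m * t)) @ (wpow wb ?d @ ?T) @ winv wa)"
    by (rule wequiv_ctx[OF wequiv.sym[OF tail_word_commute]])
  also have "wequiv R \<dots> (wa @ wpow wb (m * t + ?d) @ (?T @ winv wa))"
    using wequiv_ctx[OF wequiv.sym[OF wpow_add[of R wb "m * t" ?d]], of wa "?T @ winv wa"] by simp
  finally show ?thesis by simp
qed

lemma base_word_split:
  assumes "lim_split m rho s e = (i, e')"
  shows "wequiv R ([(GA, s)] @ base_word m \<xi> e) (base_word m \<xi> e' @ [(GA, s)] @ wpow wb i)"
proof -
  obtain c es where e: "e = (c, es)" by fastforce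
  show ?thesis
  proof (cases s)
    case False
    define t where "t = (c + rdot rho 0 es - i) div m"
    have i: "i = crem (c + rdot rho 0 es) m" and e': "e' = (0, t # es)"
      using assms False by (auto simp: e Let_def t_def)
    have c: "m * t - rdot rho 0 es + i = c"
      by (simp add: t_def i)
    let ?T = "tail_word m \<xi> 0 es" and ?w = "wpow wb (m * t - rdot rho 0 es)"
    have "wequiv R (tail_word m \<xi> 0 (t # es) @ wa @ wpow wb i)
        ((wa @ ?w @ ?T @ winv wa) @ wa @ wpow wb i)"
      by (rule wequiv_append_right[OF tail_word_Cons_conj])
    also have "wequiv R \<dots> (wa @ ?w @ ?T @ wpow wb i)"
      using wequiv_winv_left_ctx[of R "wa @ ?w @ ?T" wa "wpow wb i"] by simp
    also have "wequiv R \<dots> (wa @ ?w @ wpow wb i @ ?T)"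
      by (intro wequiv_append_left wequiv.sym[OF tail_word_commute])
    also have "wequiv R \<dots> (wa @ wpow wb c @ ?T)"
      using wequiv_ctx[OF wequiv.sym[OF wpow_add[of R wb "m * t - rdot rho 0 es" i]], of wa ?T]
      by (simp only: c append_assoc)
    finally show ?thesis
      using False by (simp add: base_word_def e e' wa_def wequiv.sym)
  next
    case True
    show ?thesis
    proof (cases es)
      case Nil
      then show ?thesis
        using True assms by (auto simp: e base_word_def wequiv.refl)
    next
      case (Cons t fs)
      let ?T = "tail_word m \<xi> 0 fs" and ?w = "wpow wb (m * t - rdot rho 0 fs)"
      have e': "i = c" "e' = (m * t - rdot rho 0 fs, fs)"
        using True assms by (auto simp: e Cons)
      have "wequiv R (winv wa @ wpow wb c @ tail_word m \<xi> 0 (t # fs))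
          (winv wa @ tail_word m \<xi> 0 (t # fs) @ wpow wb c)"
        by (rule wequiv_append_left[OF tail_word_commute])
      also have "wequiv R \<dots> (winv wa @ (wa @ ?w @ ?T @ winv wa) @ wpow wb c)"
        by (rule wequiv_ctx[OF tail_word_Cons_conj])
      also have "wequiv R \<dots> (?w @ ?T @ winv wa @ wpow wb c)"
        using wequiv_winv_left_ctx[of R "[]" wa] by simp
      finally show ?thesis
        using True by (simp add: base_word_def e e' Cons winv_wa)
    qed
  qed
qed

lemma base_word_shift:
  "wequiv R (wpow wb j @ base_word m \<xi> e) (base_word m \<xi> (lim_shift j e))"
  using wequiv_append_right[OF wequiv.sym[OF wpow_add[of R wb j "fst e"]]]
  by (simp add: base_word_def lim_shift_def)

lemma state_word_step: "wequiv R (x # state_word m \<xi> S) (state_word m \<xi> (lim_step m rho x S))"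
proof -
  obtain g s e L where x: "x = (g, s)" and S: "S = (e, L)" by fastforce
  show ?thesis
  proof (cases g)
    case GB
    have "wpow wb (if s then - 1 else 1) = [x]"
      using GB by (simp add: x winv_wb) (simp add: wb_def)
    then show ?thesis
      using GB wequiv_append_right[OF base_word_shift[of "if s then - 1 else 1" e], of "stable_word L"]
      by (simp add: x S state_word_def)
  next
    case GA
    obtain i e' where split: "lim_split m rho s e = (i, e')" by (cases "lim_split m rho s e")
    have step: "wequiv R (x # state_word m \<xi> S) (base_word m \<xi> e' @ x # wpow wb i @ stable_word L)"
      using wequiv_append_right[OF base_word_split[OF split], of "stable_word L"]
      by (simp add: x S GA state_word_def)
    show ?thesis
    proof (cases "i = 0 \<and> L \<noteq> [] \<and> fst (hd L) \<noteq> s")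
      case True
      then obtain j L' where L: "L = (\<not> s, j) # L'" by (cases L) auto
      have "linv x = (GA, \<not> s)" by (simp add: x GA linv_def)
      then have "wequiv R (base_word m \<xi> e' @ x # wpow wb i @ stable_word L)
          ((base_word m \<xi> e' @ wpow wb j) @ stable_word L')"
        using wequiv.cancel[of R "base_word m \<xi> e'" x "wpow wb j @ stable_word L'"] True by (simp add: L)
      \<comment> \<open>The power freed by the cancellation stands to the right of the base word,
        whereas \<open>lim_shift\<close> multiplies on the left.\<close>
      also have "wequiv R \<dots> ((wpow wb j @ base_word m \<xi> e') @ stable_word L')"
      proof (rule wequiv_append_right)
        have "wequiv R (wpow wb (fst e') @ tail_word m \<xi> 0 (snd e') @ wpow wb j)
            (wpow wb (fst e') @ wpow wb j @ tail_word m \<xi> 0 (snd e'))"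
          by (rule wequiv_append_left[OF wequiv.sym[OF tail_word_commute]])
        also have "wequiv R \<dots> ((wpow wb j @ wpow wb (fst e')) @ tail_word m \<xi> 0 (snd e'))"
          using wequiv_append_right[OF wequiv_commute_wpow_wpow[OF wequiv.refl[of R "wb @ wb"]]]
          by simp
        finally show "wequiv R (base_word m \<xi> e' @ wpow wb j) (wpow wb j @ base_word m \<xi> e')"
          by (simp add: base_word_def)
      qed
      also have "wequiv R \<dots> (base_word m \<xi> (lim_shift j e') @ stable_word L')"
        by (rule wequiv_append_right[OF base_word_shift])
      finally show ?thesis
        using step True by (auto simp: x S GA split L state_word_def intro: wequiv.trans)
    next
      case False
      then show ?thesis using step by (auto simp: x S GA split state_word_def)
    qed
  qed
qed

lemma wequiv_state_word: "wequiv R w (state_word m \<xi> (run (lim_step m rho) w ((0, []), [])))"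
proof (induction w)
  case Nil
  show ?case by (simp add: state_word_def base_word_def wequiv.refl)
next
  case (Cons x w)
  have "wequiv R (x # w) (x # state_word m \<xi> (run (lim_step m rho) w ((0, []), [])))"
    using wequiv_append_left[OF Cons.IH, of "[x]"] by simp
  also have "wequiv R \<dots> (state_word m \<xi> (run (lim_step m rho) (x # w) ((0, []), [])))"
    using state_word_step by simp
  finally show ?case .
qed

end

section \<open>The commutator relators in \<open>BS m q\<close>\<close>

text \<open>Conjugation by a sends \<open>b^(m y)\<close> to \<open>b^(q y)\<close>; exactness
  supplies the divisibility by m at every stage.\<close>

lemma bword_in_BS:
  assumes "quot_exact m (\<lambda>k. r_fun m \<xi> (Suc k)) q k"
    and rel: "wequiv R (wa @ wpow wb m @ winv wa) (wpow wb q)"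
  shows "wequiv R (bword m \<xi> (Suc k)) (wpow wb (q * quot m (\<lambda>k. r_fun m \<xi> (Suc k)) q k))"
  using assms(1)
proof (induction k)
  case 0
  show ?case using rel by simp
next
  case (Suc k)
  let ?\<rho> = "\<lambda>k. r_fun m \<xi> (Suc k)"
  let ?x = "q * quot m ?\<rho> q k" and ?y = "quot m ?\<rho> q (Suc k)"
  have y: "?x + - ?\<rho> k = m * ?y" and "quot_exact m ?\<rho> q k"
    using Suc.prems by (auto simp: quot_exact_def simp del: quot.simps)
  then have "wequiv R (bword m \<xi> (Suc k) @ wpow wb (- ?\<rho> k)) (wpow wb ?x @ wpow wb (- ?\<rho> k))"
    by (intro wequiv_append_right Suc.IH)
  also have "wequiv R \<dots> (wpow wb (m * ?y))"
    using wpow_add[of R wb ?x "- ?\<rho> k"] unfolding y by (rule wequiv.sym)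
  also have "wequiv R \<dots> (wpow (wpow wb m) ?y)"
    by (rule wpow_mult)
  finally have "wequiv R (wa @ (bword m \<xi> (Suc k) @ wpow wb (- ?\<rho> k)) @ winv wa)
      (wa @ wpow (wpow wb m) ?y @ winv wa)"
    by (rule wequiv_ctx)
  also have "wequiv R \<dots> (wpow (wa @ wpow wb m @ winv wa) ?y)"
    by (rule wpow_conj)
  also have "wequiv R \<dots> (wpow (wpow wb q) ?y)"
    by (rule wpow_cong[OF rel])
  also have "wequiv R \<dots> (wpow wb (q * ?y))"
    by (rule wequiv.sym[OF wpow_mult])
  finally show ?case by (simp del: quot.simps)
qed

lemma relator_BS:
  "wequiv {wa @ wpow wb m @ winv wa @ wpow wb (- q)} (wa @ wpow wb m @ winv wa) (wpow wb q)"
proof -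
  let ?R = "{wa @ wpow wb m @ winv wa @ wpow wb (- q)}"
  have "wequiv ?R ((wa @ wpow wb m @ winv wa) @ wpow wb (- q + q))
      ((wa @ wpow wb m @ winv wa) @ wpow wb (- q) @ wpow wb q)"
    by (rule wequiv_append_left[OF wpow_add])
  also have "wequiv ?R \<dots> (wpow wb q)"
    using wequiv.rel[of "wa @ wpow wb m @ winv wa @ wpow wb (- q)" ?R "[]" "wpow wb q"] by simp
  finally show ?thesis by simp
qed

lemma comm_bword_in_BS:
  assumes "quot_exact m (\<lambda>k. r_fun m \<xi> (Suc k)) q k"
  shows "comm wb (bword m \<xi> (Suc k)) \<in> BS m q"
proof -
  let ?R = "{wa @ wpow wb m @ winv wa @ wpow wb (- q)}"
  let ?x = "q * quot m (\<lambda>k. r_fun m \<xi> (Suc k)) q k"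
  have b: "wequiv ?R (bword m \<xi> (Suc k)) (wpow wb ?x)"
    by (rule bword_in_BS[OF assms relator_BS])
  have "wequiv ?R (wb @ bword m \<xi> (Suc k)) (wb @ wpow wb ?x)"
    by (rule wequiv_append_left[OF b])
  also have "wequiv ?R \<dots> (wpow wb ?x @ wb)"
    by (rule wequiv_commute_wpow[OF wequiv.refl])
  also have "wequiv ?R \<dots> (bword m \<xi> (Suc k) @ wb)"
    by (rule wequiv_append_right[OF wequiv.sym[OF b]])
  finally show ?thesis
    by (simp add: BS_def presented_def wequiv_comm_iff)
qed

subsection \<open>Convergence\<close>

text \<open>A derivation uses finitely many relators, and each of them holds in
  \<open>BS m q\<close> for eventually all q.\<close>

lemma wequiv_bword_in_BS:
  assumes exact: "\<And>h. eventually (\<lambda>q. quot_exact m (\<lambda>k. r_fun m \<xi> (Suc k)) q h) F"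
    and "wequiv {comm wb (bword m \<xi> i) | i. i \<ge> 1} u v"
  shows "eventually (\<lambda>q. wequiv {wa @ wpow wb m @ winv wa @ wpow wb (- q)} u v) F"
  using assms(2)
proof (induction rule: wequiv.induct)
  case (sym u v)
  from sym.IH show ?case by eventually_elim (rule wequiv.sym)
next
  case (trans u v w)
  from trans.IH show ?case by eventually_elim (rule wequiv.trans)
next
  case (rel r u v)
  then obtain i where i: "r = comm wb (bword m \<xi> i)" "i \<ge> 1" by blast
  then obtain k where k: "i = Suc k" by (cases i) auto
  from exact[of k] show ?case
  proof eventually_elim
    case (elim q)
    have "wequiv {wa @ wpow wb m @ winv wa @ wpow wb (- q)} r []"
      using comm_bword_in_BS[OF elim] by (simp add: i k BS_def presented_def)
    then show ?case using wequiv_ctx[of _ r "[]" u v] by simp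
  qed
qed (simp_all add: wequiv.refl wequiv.cancel del: append.simps append_Cons)

lemma eventually_BS_iff:
  assumes "m \<noteq> 0"
    and large: "\<And>B. eventually (\<lambda>q. B < \<bar>q\<bar>) F"
    and exact: "\<And>h. eventually (\<lambda>q. quot_exact m (\<lambda>k. r_fun m \<xi> (Suc k)) q h) F"
  shows "eventually (\<lambda>q. w \<in> BS m q \<longleftrightarrow> w \<in> presented {comm wb (bword m \<xi> i) | i. i \<ge> 1}) F"
proof -
  let ?R = "{comm wb (bword m \<xi> i) | i. i \<ge> 1}"
  let ?\<rho> = "\<lambda>k. r_fun m \<xi> (Suc k)"
  interpret approximation m ?\<rho> F
    by standard (use assms in auto)
  interpret commuting_relators ?R m \<xi>
  proof
    fix k
    have "comm wb (bword m \<xi> (Suc k)) \<in> ?R" by force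
    from wequiv.rel[OF this, of "[]" "[]"]
    show "wequiv ?R (wb @ bword m \<xi> (Suc k)) (bword m \<xi> (Suc k) @ wb)"
      by (simp add: wequiv_comm_iff)
  qed
  have presented: "eventually (\<lambda>q. w \<in> BS m q) F" if "w \<in> presented ?R"
    using wequiv_bword_in_BS[OF exact] that by (simp add: BS_def presented_def)
  obtain c es L where S: "run (lim_step m ?\<rho>) w ((0, []), []) = ((c, es), L)"
    by (metis surj_pair)
  show ?thesis
  proof (cases "L = [] \<and> c = 0 \<and> (\<forall>e\<in>set es. e = 0)")
    case True
    \<comment> \<open>The exponent list may be a nonempty list of zeros, which still stands for the
      identity.\<close>
    have "tail_word m \<xi> k es = []" for k
      using True by (induction es arbitrary: k) auto
    then have "w \<in> presented ?R"
      using wequiv_state_word[of w] True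
      by (simp add: S presented_def state_word_def base_word_def)
    then show ?thesis using presented by simp
  next
    case False
    have "eventually (\<lambda>q. (lim_val m ?\<rho> q (c, es), L) \<noteq> (0, [])) F"
    proof (cases "L = []")
      case True
      then show ?thesis using False eventually_lim_val_nonzero[of c es] by simp
    qed simp
    with eventually_run[of w] large[of 0]
    have notin: "eventually (\<lambda>q. w \<notin> BS m q) F"
    proof eventually_elim
      case (elim q)
      then show ?case using run_bs_trivial[of w m q] assms(1) S by auto
    qed
    \<comment> \<open>F may be the trivial filter, so the clash between \<open>presented\<close> and
      \<open>notin\<close> is resolved under \<open>eventually\<close>.\<close>
    show ?thesis
    proof (cases "w \<in> presented ?R")
      case True
      from presented[OF True] notin show ?thesis by eventually_elim simp
    qed (use notin in simp)
  qed
qed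

text \<open>Finiteness of balls turns eventual agreement on each word into the uniform agreement
  demanded by \<open>mconv\<close>.\<close>

lemma finite_words: "finite {w :: word. length w \<le> l}"
proof -
  have "x \<in> {GA, GB}" for x by (cases x) auto
  then have "finite (UNIV :: gen set)" by (intro finite_subset[of UNIV "{GA, GB}"]) auto
  then have "finite (UNIV :: letter set)" by (simp add: finite_prod)
  then show ?thesis using finite_lists_length_le[of UNIV l] by simp
qed

lemma mconv_unique:
  assumes "mconv N L" "mconv N L'"
  shows "L = L'"
proof (rule set_eqI)
  fix w :: word
  have "eventually (\<lambda>n. \<forall>v. length v \<le> length w \<longrightarrow> (v \<in> N n \<longleftrightarrow> v \<in> L)) sequentially"
    "eventually (\<lambda>n. \<forall>v. length v \<le> length w \<longrightarrow> (v \<in> N n \<longleftrightarrow> v \<in> L')) sequentially"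
    using assms by (auto simp: mconv_def)
  then have "eventually (\<lambda>n. w \<in> L \<longleftrightarrow> w \<in> L') sequentially"
    by eventually_elim auto
  then show "w \<in> L \<longleftrightarrow> w \<in> L'" by simp
qed

subsection \<open>Division by m in the m-adic integers\<close>

lemma Zm_mod:
  assumes "x \<in> Zm m" "h \<le> k"
  shows "x k mod \<bar>m\<bar> ^ h = x h"
  using assms(2)
proof (induction rule: dec_induct)
  case base
  show ?case using assms(1) by (simp add: Zm_def)
next
  case (step n)
  have "\<bar>m\<bar> ^ h dvd \<bar>m\<bar> ^ n" using step.hyps by (simp add: le_imp_power_dvd)
  then have "x (Suc n) mod \<bar>m\<bar> ^ h = x (Suc n) mod \<bar>m\<bar> ^ n mod \<bar>m\<bar> ^ h"
    by (simp add: mod_mod_cancel)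
  also have "x (Suc n) mod \<bar>m\<bar> ^ n = x n" using assms(1) by (simp add: Zm_def)
  finally show ?case using step.IH by simp
qed

lemma zm_of_int_in_Zm: "m \<noteq> 0 \<Longrightarrow> zm_of_int m n \<in> Zm m"
  by (simp add: Zm_def zm_of_int_def mod_mod_cancel le_imp_power_dvd)

lemma zm_mult_in_Zm:
  assumes "m \<noteq> 0" "x \<in> Zm m" "y \<in> Zm m"
  shows "zm_mult m x y \<in> Zm m"
proof -
  have "x (Suc h) * y (Suc h) mod \<bar>m\<bar> ^ Suc h mod \<bar>m\<bar> ^ h = x h * y h mod \<bar>m\<bar> ^ h" for h
  proof -
    have "x (Suc h) * y (Suc h) mod \<bar>m\<bar> ^ Suc h mod \<bar>m\<bar> ^ h = x (Suc h) * y (Suc h) mod \<bar>m\<bar> ^ h"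
      by (simp add: mod_mod_cancel)
    also have "\<dots> = (x (Suc h) mod \<bar>m\<bar> ^ h) * (y (Suc h) mod \<bar>m\<bar> ^ h) mod \<bar>m\<bar> ^ h"
      by (simp add: mod_mult_eq)
    finally show ?thesis using assms(2,3) by (simp add: Zm_def)
  qed
  then show ?thesis using assms(1) by (simp add: Zm_def zm_mult_def)
qed

lemma zm_affine:
  "zm_add m (zm_mult m (zm_of_int m m) s) (zm_of_int m r) h = (m * s h + r) mod \<bar>m\<bar> ^ h"
  by (simp add: zm_add_def zm_mult_def zm_of_int_def mod_simps)

text \<open>The remainder is the residue of y modulo m, and the quotient is computed levelwise.
  Unique existence resolves the description in \<open>r_s\<close>.\<close>

lemma zm_division:
  assumes "m \<noteq> 0" "y \<in> Zm m"
  shows "\<exists>!p. case p of (r, s) \<Rightarrow> 0 \<le> r \<and> r < \<bar>m\<bar> \<and> s \<in> Zm m \<and>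
    y = zm_add m (zm_mult m (zm_of_int m m) s) (zm_of_int m r)"
proof -
  define P where "P = (\<lambda>r s. 0 \<le> r \<and> r < \<bar>m\<bar> \<and> s \<in> Zm m \<and> (\<forall>h. y h = (m * s h + r) mod \<bar>m\<bar> ^ h))"
  define r where "r = y 1"
  \<comment> \<open>Division by m loses one digit, so level h of the quotient is read off level h +
    1 of y.\<close>
  define z where "z = (\<lambda>h. (y (Suc h) - r) div m)"
  define s where "s = (\<lambda>h. z h mod \<bar>m\<bar> ^ h)"
  have z: "m * z h = y (Suc h) - r" for h
  proof -
    have "y (Suc h) mod \<bar>m\<bar> = r"
      using Zm_mod[OF assms(2), of 1 "Suc h"] by (simp add: r_def)
    then have "\<bar>m\<bar> dvd y (Suc h) - r" by (metis dvd_minus_mod)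
    then show ?thesis by (simp add: z_def)
  qed
  have s: "s \<in> Zm m"
  proof -
    have "z (Suc h) mod \<bar>m\<bar> ^ h = z h mod \<bar>m\<bar> ^ h" for h
    proof -
      have "y (Suc (Suc h)) mod \<bar>m\<bar> ^ Suc h = y (Suc h)"
        using assms(2) by (simp only: Zm_def mem_Collect_eq)
      then have "\<bar>m\<bar> ^ Suc h dvd y (Suc (Suc h)) - y (Suc h)" by (metis dvd_minus_mod)
      also have "y (Suc (Suc h)) - y (Suc h) = m * (z (Suc h) - z h)"
        using z[of h] z[of "Suc h"] by (simp add: right_diff_distrib)
      finally have "\<bar>m\<bar> * \<bar>m\<bar> ^ h dvd \<bar>m\<bar> * \<bar>z (Suc h) - z h\<bar>"
        by (simp add: abs_mult[symmetric])
      then have "\<bar>m\<bar> ^ h dvd z (Suc h) - z h" using assms(1) by simp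
      then show ?thesis by (simp add: mod_eq_dvd_iff)
    qed
    then show ?thesis using assms(1) by (simp add: Zm_def s_def mod_mod_cancel le_imp_power_dvd)
  qed
  have ex: "P r s"
  proof -
    have "(m * s h + r) mod \<bar>m\<bar> ^ h = y h" for h
    proof -
      have "(m * s h + r) mod \<bar>m\<bar> ^ h = (m * z h + r) mod \<bar>m\<bar> ^ h"
        unfolding s_def by (metis mod_add_left_eq mod_mult_right_eq)
      also have "\<dots> = y (Suc h) mod \<bar>m\<bar> ^ h" by (simp add: z)
      finally show ?thesis using assms(2) by (simp add: Zm_def)
    qed
    moreover have "0 \<le> y 1 \<and> y 1 < \<bar>m\<bar> ^ 1"
      using assms(2) unfolding Zm_def by blast
    ultimately show ?thesis using s by (simp add: P_def r_def)
  qed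
  have unique: "r' = r \<and> s' = s" if "P r' s'" for r' s'
  proof
    have y: "y h = (m * s' h + r') mod \<bar>m\<bar> ^ h" for h using that by (simp add: P_def)
    have "(m * s' 1 + r') mod \<bar>m\<bar> = r' mod \<bar>m\<bar>"
    proof -
      have "\<bar>m\<bar> dvd (m * s' 1 + r') - r'" by simp
      then show ?thesis by (simp only: mod_eq_dvd_iff)
    qed
    then show r: "r' = r" using y[of 1] that by (simp add: r_def P_def)
    have y': "y h = (m * s h + r) mod \<bar>m\<bar> ^ h" for h using ex by (simp add: P_def)
    show "s' = s"
    proof
      fix h
      \<comment> \<open>Again one level is lost: agreement at level h needs the equation at level h
        + 1.\<close>
      have "\<bar>m\<bar> ^ Suc h dvd (m * s' (Suc h) + r) - (m * s (Suc h) + r)"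
        using y[of "Suc h"] y'[of "Suc h"] r by (simp only: mod_eq_dvd_iff[symmetric])
      then have "\<bar>m\<bar> * \<bar>m\<bar> ^ h dvd \<bar>m\<bar> * \<bar>s' (Suc h) - s (Suc h)\<bar>"
        by (simp add: abs_mult[symmetric] right_diff_distrib)
      then have "\<bar>m\<bar> ^ h dvd s' (Suc h) - s (Suc h)" using assms(1) by simp
      then have "s' (Suc h) mod \<bar>m\<bar> ^ h = s (Suc h) mod \<bar>m\<bar> ^ h" by (simp add: mod_eq_dvd_iff)
      then show "s' h = s h" using s that by (simp add: Zm_def P_def)
    qed
  qed
  have "\<exists>!p. case p of (r, s) \<Rightarrow> P r s"
  proof (rule ex1I[of _ "(r, s)"])
    fix p
    assume "case p of (r, s) \<Rightarrow> P r s"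
    then show "p = (r, s)" using unique[of "fst p" "snd p"] by (simp add: case_prod_beta prod_eq_iff)
  qed (simp add: ex)
  then show ?thesis by (simp add: P_def fun_eq_iff zm_affine)
qed

lemma r_s_Suc:
  assumes "m \<noteq> 0" "\<xi> \<in> Zm m" "snd (r_s m \<xi> i) \<in> Zm m"
  shows "snd (r_s m \<xi> (Suc i)) \<in> Zm m"
    and "zm_mult m \<xi> (snd (r_s m \<xi> i)) =
      zm_add m (zm_mult m (zm_of_int m m) (snd (r_s m \<xi> (Suc i)))) (zm_of_int m (r_fun m \<xi> (Suc i)))"
  using theI'[OF zm_division[OF assms(1) zm_mult_in_Zm[OF assms]]]
  unfolding r_fun_def r_s.simps by (auto split: prod.splits)

lemma snd_r_s_in_Zm:
  assumes "m \<noteq> 0" "\<xi> \<in> Zm m"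
  shows "snd (r_s m \<xi> i) \<in> Zm m"
proof (induction i)
  case 0
  show ?case using assms(1) by (simp add: zm_of_int_in_Zm)
next
  case (Suc i)
  then show ?case by (rule r_s_Suc(1)[OF assms])
qed

lemma r_s_zero:
  assumes "m \<noteq> 0"
  shows "r_s m (zm_of_int m 0) (Suc i) = (0, zm_of_int m 0)"
proof -
  let ?y = "zm_mult m (zm_of_int m 0) (snd (r_s m (zm_of_int m 0) i))"
  have y: "?y \<in> Zm m"
    using assms by (intro zm_mult_in_Zm zm_of_int_in_Zm snd_r_s_in_Zm)
  have "?y = zm_add m (zm_mult m (zm_of_int m m) (zm_of_int m 0)) (zm_of_int m 0)"
    by (simp add: zm_mult_def zm_add_def zm_of_int_def)
  then show ?thesis
    unfolding r_s.simps using assms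
    by (intro the1_equality[OF zm_division[OF assms y]]) (simp add: zm_of_int_in_Zm)
qed

text \<open>The integers \<open>quot\<close> follow the recursion of the m-adic \<open>s_k\<close>,
  and each division costs one digit of agreement; h known digits of q thus allow h exact
  divisions.\<close>

lemma quot_exact_approx:
  assumes "m \<noteq> 0" "\<xi> \<in> Zm m" "zm_of_int m q h = \<xi> h"
  shows "quot_exact m (\<lambda>k. r_fun m \<xi> (Suc k)) q h"
proof -
  let ?M = "\<bar>m\<bar>"
  define \<rho> where "\<rho> = (\<lambda>k. r_fun m \<xi> (Suc k))"
  define s where "s = (\<lambda>k. snd (r_s m \<xi> k))"
  have s: "s k \<in> Zm m" for k
    using snd_r_s_in_Zm[OF assms(1,2)] by (simp add: s_def)
  have rec: "(\<xi> n * s k n) mod ?M ^ n = (m * s (Suc k) n + \<rho> k) mod ?M ^ n" for k n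
    using fun_cong[OF r_s_Suc(2)[OF assms(1,2) s[unfolded s_def]], of k n]
    unfolding zm_affine by (simp add: zm_mult_def s_def \<rho>_def)
  have q: "q mod ?M ^ n = \<xi> n" if "n \<le> h" for n
  proof -
    have "q mod ?M ^ n = q mod ?M ^ h mod ?M ^ n"
      using that by (simp add: mod_mod_cancel le_imp_power_dvd)
    then show ?thesis
      using assms(3) Zm_mod[OF assms(2) that] by (simp add: zm_of_int_def)
  qed
  have step: "m * quot m \<rho> q (Suc k) = q * quot m \<rho> q k - \<rho> k \<and>
      quot m \<rho> q (Suc k) mod ?M ^ n = s (Suc k) n"
    if "Suc n \<le> h" and IH: "quot m \<rho> q k mod ?M ^ Suc n = s k (Suc n)" for k n
  proof -
    let ?N = "?M ^ Suc n"
    have "q * quot m \<rho> q k mod ?N = (q mod ?N) * (quot m \<rho> q k mod ?N) mod ?N"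
      by (simp only: mod_mult_eq)
    also have "\<dots> = (m * s (Suc k) (Suc n) + \<rho> k) mod ?N"
      unfolding q[OF that(1)] IH by (rule rec)
    finally have dvd: "?N dvd q * quot m \<rho> q k - (m * s (Suc k) (Suc n) + \<rho> k)"
      by (simp only: mod_eq_dvd_iff)
    moreover have "?M dvd ?N" by simp
    ultimately have "?M dvd (q * quot m \<rho> q k - (m * s (Suc k) (Suc n) + \<rho> k)) + m * s (Suc k) (Suc n)"
      by (intro dvd_add) (blast intro: dvd_trans, simp)
    then have "m dvd q * quot m \<rho> q k - \<rho> k" by (simp add: algebra_simps)
    then have 1: "m * quot m \<rho> q (Suc k) = q * quot m \<rho> q k - \<rho> k" by simp
    then have "q * quot m \<rho> q k - (m * s (Suc k) (Suc n) + \<rho> k) =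
        m * (quot m \<rho> q (Suc k) - s (Suc k) (Suc n))"
      unfolding right_diff_distrib by linarith
    with dvd have "?M * ?M ^ n dvd m * (quot m \<rho> q (Suc k) - s (Suc k) (Suc n))"
      by (simp only: power_Suc)
    then have "?M * ?M ^ n dvd ?M * \<bar>quot m \<rho> q (Suc k) - s (Suc k) (Suc n)\<bar>"
      by (simp only: abs_mult[symmetric] dvd_abs_iff)
    then have "?M ^ n dvd quot m \<rho> q (Suc k) - s (Suc k) (Suc n)"
      using assms(1) by (simp only: dvd_mult_cancel_left abs_eq_0 dvd_abs_iff simp_thms)
    then have "quot m \<rho> q (Suc k) mod ?M ^ n = s (Suc k) (Suc n) mod ?M ^ n"
      by (simp only: mod_eq_dvd_iff)
    also have "\<dots> = s (Suc k) n" using Zm_mod[OF s, of n "Suc n"] by simp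
    finally show ?thesis using 1 by blast
  qed
  \<comment> \<open>The digit budget: after k divisions, agreement with \<open>s k\<close> remains
    up to level h - k.\<close>
  have approx: "quot m \<rho> q k mod ?M ^ n = s k n" if "k + n \<le> h" for k n
    using that
  proof (induction k arbitrary: n)
    case 0
    show ?case by (simp add: s_def zm_of_int_def)
  next
    case (Suc k)
    then show ?case using step[of n k] Suc.IH[of "Suc n"] by (simp del: quot.simps)
  qed
  have "m * quot m \<rho> q (Suc k) = q * quot m \<rho> q k - \<rho> k" if "k < h" for k
    using step[of 0 k] approx[of k "Suc 0"] that by (simp del: quot.simps)
  then show ?thesis by (simp add: quot_exact_def \<rho>_def del: quot.simps)
qed

section \<open>Identification of the limit group\<close>

lemma mconv_BS:
  assumes "m \<noteq> 0" "\<xi> \<in> Zm m"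
    and large: "filterlim (\<lambda>n. \<bar>seq n\<bar>) at_top sequentially"
    and approx: "\<And>h. eventually (\<lambda>n. zm_of_int m (seq n) h = \<xi> h) sequentially"
  shows "mconv (\<lambda>n. BS m (seq n)) (presented {comm wb (bword m \<xi> i) | i. i \<ge> 1})"
proof -
  let ?L = "presented {comm wb (bword m \<xi> i) | i. i \<ge> 1}"
  have "eventually (\<lambda>q. w \<in> BS m q \<longleftrightarrow> w \<in> ?L) (filtermap seq sequentially)" for w
  proof (rule eventually_BS_iff[OF assms(1)])
    show "eventually (\<lambda>q. B < \<bar>q\<bar>) (filtermap seq sequentially)" for B
      using large[unfolded filterlim_at_top, rule_format, of "B + 1"]
      unfolding eventually_filtermap by eventually_elim simp
    show "eventually (\<lambda>q. quot_exact m (\<lambda>k. r_fun m \<xi> (Suc k)) q h) (filtermap seq sequentially)" for h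
      unfolding eventually_filtermap
      using approx[of h] by eventually_elim (rule quot_exact_approx[OF assms(1,2)])
  qed
  then have "eventually (\<lambda>n. \<forall>w\<in>{w. length w \<le> l}. w \<in> BS m (seq n) \<longleftrightarrow> w \<in> ?L) sequentially" for l
    by (intro eventually_ball_finite finite_words) (simp add: eventually_filtermap)
  then show ?thesis by (simp add: mconv_def)
qed

text \<open>Without such a sequence the condition defining \<open>barBS\<close> would be vacuous and
  would not determine L.\<close>

lemma ex_approximating_sequence:
  assumes "m \<noteq> 0" "\<xi> \<in> Zm m"
  shows "\<exists>seq :: nat \<Rightarrow> int. filterlim (\<lambda>n. \<bar>seq n\<bar>) at_top sequentially \<and>
    (\<forall>h. eventually (\<lambda>n. zm_of_int m (seq n) h = \<xi> h) sequentially)"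
proof (intro exI conjI allI)
  \<comment> \<open>The added multiple of \<open>\<bar>m\<bar> ^ n\<close> preserves the first n
    digits; its factor n forces divergence even if \<open>\<bar>m\<bar>\<close> is 1 or \<xi> comes
    from an integer.\<close>
  let ?seq = "\<lambda>n. \<xi> n + \<bar>m\<bar> ^ n * int n"
  have le: "int n \<le> \<bar>?seq n\<bar>" for n
  proof -
    have "0 \<le> \<xi> n" using assms(2) by (simp add: Zm_def)
    moreover have "1 * int n \<le> \<bar>m\<bar> ^ n * int n"
      using assms(1) by (intro mult_right_mono) (auto simp: one_le_power)
    ultimately show ?thesis by simp
  qed
  have "filterlim int at_top sequentially"
    unfolding filterlim_at_top
  proof
    show "eventually (\<lambda>n. Z \<le> int n) sequentially" for Z
      by (rule eventually_sequentiallyI[of "nat Z"]) simp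
  qed
  then show "filterlim (\<lambda>n. \<bar>?seq n\<bar>) at_top sequentially"
    by (rule filterlim_at_top_mono) (simp only: le always_eventually simp_thms)
  fix h
  show "eventually (\<lambda>n. zm_of_int m (?seq n) h = \<xi> h) sequentially"
    using eventually_ge_at_top[of h]
  proof eventually_elim
    case (elim n)
    have "\<bar>m\<bar> ^ h dvd \<bar>m\<bar> ^ n * int n" using elim by (simp add: le_imp_power_dvd)
    then have "?seq n mod \<bar>m\<bar> ^ h = \<xi> n mod \<bar>m\<bar> ^ h"
      by (metis add_diff_cancel_left' mod_eq_dvd_iff)
    then show ?case using Zm_mod[OF assms(2) elim] by (simp add: zm_of_int_def)
  qed
qed

lemma barBS_eq:
  assumes "m \<noteq> 0" "\<xi> \<in> Zm m"
  shows "barBS m \<xi> = presented {comm wb (bword m \<xi> i) | i. i \<ge> 1}"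
  unfolding barBS_def
proof (rule the_equality)
  show "\<forall>seq. filterlim (\<lambda>n. \<bar>seq n\<bar>) at_top sequentially \<and>
      (\<forall>h. eventually (\<lambda>n. zm_of_int m (seq n) h = \<xi> h) sequentially)
      \<longrightarrow> mconv (\<lambda>n. BS m (seq n)) (presented {comm wb (bword m \<xi> i) | i. i \<ge> 1})"
    using mconv_BS[OF assms] by blast
next
  fix L
  assume "\<forall>seq. filterlim (\<lambda>n. \<bar>seq n\<bar>) at_top sequentially \<and>
      (\<forall>h. eventually (\<lambda>n. zm_of_int m (seq n) h = \<xi> h) sequentially)
      \<longrightarrow> mconv (\<lambda>n. BS m (seq n)) L"
  then show "L = presented {comm wb (bword m \<xi> i) | i. i \<ge> 1}"
    using ex_approximating_sequence[OF assms] mconv_BS[OF assms] mconv_unique by blast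
qed

section \<open>The case of the zero m-adic integer\<close>

lemma wpow_nat_Suc_right: "wpow_nat w (Suc n) = wpow_nat w n @ w"
  by (induction n) auto

text \<open>All remainders vanish, so the recursion only conjugates by a. Equality holds literally
  for words, which makes the two relator sets equal.\<close>

lemma bword_zero:
  assumes "m \<noteq> 0" "i \<ge> 1"
  shows "bword m (zm_of_int m 0) i = wpow wa (int i) @ wpow wb m @ wpow wa (- int i)"
proof -
  have "bword m (zm_of_int m 0) (Suc n) =
      wpow_nat wa (Suc n) @ wpow wb m @ wpow_nat (winv wa) (Suc n)" for n
  proof (induction n)
    case (Suc n)
    have "r_fun m (zm_of_int m 0) (Suc n) = 0"
      using r_s_zero[OF assms(1)] by (simp only: r_fun_def fst_conv)
    then show ?case
      using Suc wpow_nat_Suc_right[of "winv wa" "Suc n"] by simp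
  qed simp
  then show ?thesis
    using assms(2) by (cases i) (simp_all add: wpow_def nat_add_distrib del: wpow_nat.simps)
qed

theorem theorem3p1:
  fixes m :: int and \<xi> :: "nat \<Rightarrow> int"
  assumes "m \<noteq> 0" and "\<xi> \<in> Zm m"
  shows "barBS m \<xi> = presented {comm wb (bword m \<xi> i) | i. i \<ge> 1}
    \<and> barBS m (zm_of_int m 0) =
        presented {comm wb (wpow wa (int i) @ wpow wb m @ wpow wa (- int i)) | i. i \<ge> 1}
    \<and> (\<forall>k::nat. k \<ge> 1 \<longrightarrow>
        comm wb (wpow wa (int k) @ wpow wb m @ wpow wa (- int k))
          \<notin> presented {comm wb (wpow wa (int i) @ wpow wb m @ wpow wa (- int i)) | i. i \<ge> 1 \<and> i \<noteq> k})"
proof (intro conjI allI impI)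
  show "barBS m \<xi> = presented {comm wb (bword m \<xi> i) | i. i \<ge> 1}"
    by (rule barBS_eq[OF assms])
  have "{comm wb (bword m (zm_of_int m 0) i) | i. i \<ge> 1} =
      {comm wb (wpow wa (int i) @ wpow wb m @ wpow wa (- int i)) | i. i \<ge> 1}"
    using bword_zero[OF assms(1)] by metis
  then show "barBS m (zm_of_int m 0) =
      presented {comm wb (wpow wa (int i) @ wpow wb m @ wpow wa (- int i)) | i. i \<ge> 1}"
    using barBS_eq[OF assms(1) zm_of_int_in_Zm[OF assms(1)]] by simp
qed (rule conj_relators_independent[OF assms(1)])

end
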